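(* Let $\mathcal{K}\subset\mathbb{R}^2$ be a simple closed continuous curve in the plane. Then $\mathcal{K}$ separates its complement into two open sets of which it is the common boundary; that is, $\mathbb{R}^2\setminus\mathcal{K}$ is the disjoint union of two open sets $\mathcal{K}_{\mathrm{ext}}$ and $\mathcal{K}_{\mathrm{int}}$ with $\partial\mathcal{K}_{\mathrm{ext}}=\partial\mathcal{K}_{\mathrm{int}}=\mathcal{K}$. Moreover, $\mathcal{K}_{\mathrm{ext}}$ (the outer region) is an open, unbounded, path-connected set, and $\mathcal{K}_{\mathrm{int}}$ (the inner region) is an open, simply path-connected, bounded set.
   Context: A simple closed continuous curve is a set $\mathcal{K}=\{K(t):0\le t<1\}$, where $K:\mathbb{R}\to\mathbb{R}^2$ is a continuous $1$-periodic function which is injective modulo $1$ (i.e. $K(t)=K(t')$ implies $t-t'\in\mathbb{Z}$). "Simply path-connected" means path-connected and simply connected (every closed path in the set is contractible within the set). *)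

theory Defs
  imports "HOL-Analysis.Analysis"
begin

definition simple_closed_curve :: "(real ^ 2) set \<Rightarrow> bool" where
  "simple_closed_curve C \<longleftrightarrow>
     (\<exists>K :: real \<Rightarrow> real ^ 2.
        continuous_on UNIV K \<and>
        (\<forall>t. K (t + 1) = K t) \<and>
        (\<forall>t t'. K t = K t' \<longrightarrow> t - t' \<in> \<int>) \<and>
        C = K ` {0..<1})"

end

theory Submission
  imports Defs "HOL-Complex_Analysis.Complex_Analysis"
begin

text \<open>The Jordan curve theorem and the simple connectedness of the inside are known for the complex
  plane; they are carried over to \<open>\<real>\<^sup>2\<close> by a linear isomorphism.\<close>

text \<open>The periodic map \<open>K\<close> itself serves as the path, since path notions only
  look at its values on \<open>{0..1}\<close>; injectivity modulo 1 then leaves only the two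
  endpoints identified.\<close>

lemma simple_closed_curve_imp_simple_path:
  assumes "simple_closed_curve C"
  obtains p where "simple_path p" "pathfinish p = pathstart p" "path_image p = C"
proof -
  obtain K :: "real \<Rightarrow> real ^ 2" where cont: "continuous_on UNIV K"
    and per: "\<And>t. K (t + 1) = K t"
    and inj: "\<And>t t'. K t = K t' \<Longrightarrow> t - t' \<in> \<int>" and C: "C = K ` {0..<1}"
    using assms unfolding simple_closed_curve_def by blast
  have K1: "K 1 = K 0"
    using per[of 0] by simp
  have "loop_free K"
    unfolding loop_free_def
  proof (intro ballI impI)
    fix x y :: real
    assume xy: "x \<in> {0..1}" "y \<in> {0..1}" and "K x = K y"
    then obtain n where n: "x - y = of_int n"
      using inj Ints_cases by blast
    \<comment> \<open>Two points of the unit interval are at most 1 apart, and the differences 1 and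
      -1 occur only for the endpoint pairs that \<open>loop_free\<close> permits.\<close>
    with xy have "real_of_int n \<le> 1" "- 1 \<le> real_of_int n"
      by auto
    then have "n = - 1 \<or> n = 0 \<or> n = 1"
      by linarith
    then show "x = y \<or> x = 0 \<and> y = 1 \<or> x = 1 \<and> y = 0"
      using n xy by auto
  qed
  moreover have "path K"
    unfolding path_def using cont continuous_on_subset by blast
  ultimately have "simple_path K"
    by (simp add: simple_path_def)
  moreover have "pathfinish K = pathstart K"
    by (simp add: pathfinish_def pathstart_def K1)
  \<comment> \<open>The curve is an image of the half-open interval, a path image one of the closed
    interval; the extra point \<open>K 1\<close> is already \<open>K 0\<close>.\<close>
  moreover have "{0..1} = insert 1 {0..<1::real}"
    by auto
  then have "path_image K = C"
    unfolding path_image_def C using K1 by auto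
  ultimately show ?thesis
    using that by blast
qed

text \<open>Linear bijections commute with closure and interior, and injectivity lets the image pass
  through the set difference.\<close>

lemma frontier_bijective_linear_image:
  fixes f :: "'a::euclidean_space \<Rightarrow> 'b::euclidean_space"
  assumes "linear f" "bij f"
  shows "frontier (f ` S) = f ` frontier S"
  using assms
  by (simp add: frontier_def interior_bijective_linear_image image_set_diff bij_is_inj
      flip: closure_injective_linear_image)

lemma simply_connected_bijective_linear_image:
  fixes f :: "'a::euclidean_space \<Rightarrow> 'b::euclidean_space"
  assumes "linear f" "bij f" "simply_connected S"
  shows "simply_connected (f ` S)"
  using homeomorphic_simply_connected linear_homeomorphic_image[of f S] assms bij_is_inj by blast

theorem mainTheorem1:
  fixes C :: "(real ^ 2) set"
  assumes "simple_closed_curve C"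
  shows "\<exists>C_ext C_int.
           - C = C_ext \<union> C_int \<and> C_ext \<inter> C_int = {} \<and>
           frontier C_ext = C \<and> frontier C_int = C \<and>
           open C_ext \<and> \<not> bounded C_ext \<and> path_connected C_ext \<and>
           open C_int \<and> bounded C_int \<and> path_connected C_int \<and> simply_connected C_int"
proof -
  obtain p where p: "simple_path p" "pathfinish p = pathstart p" "path_image p = C"
    using simple_closed_curve_imp_simple_path assms by metis
  have dim: "DIM(real ^ 2) = DIM(complex)"
    by simp
  obtain f :: "real ^ 2 \<Rightarrow> complex" and g :: "complex \<Rightarrow> real ^ 2"
    where fg: "linear f" "linear g" "\<And>x. g (f x) = x" "\<And>z. f (g z) = z"
    by (rule isomorphisms_UNIV_UNIV[OF dim]) blast
  have bij: "bij f" "bij g"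
    using fg o_bij[of g f] o_bij[of f g] by (simp_all add: fun_eq_iff)
  let ?c = "f \<circ> p"
  let ?I = "inside (path_image ?c)" and ?O = "outside (path_image ?c)"
  have c: "simple_path ?c" "pathfinish ?c = pathstart ?c"
    using p fg bij by (simp_all add: simple_path_linear_image_eq bij_is_inj pathfinish_compose pathstart_compose)
  note J = Jordan_inside_outside[OF c]
  have gc: "g ` path_image ?c = C"
    using fg p by (simp add: path_image_compose image_image)
  have sc: "simply_connected (g ` ?I)"
    by (intro simply_connected_bijective_linear_image simply_connected_inside_simple_path fg bij c)
  \<comment> \<open>Since \<open>g\<close> is a bijection, it maps the complement of the complex
    curve onto the complement of \<open>C\<close>.\<close>
  have "- C = g ` ?O \<union> g ` ?I"
    using J gc bij_image_Compl_eq[OF bij(2), of "path_image ?c"] by (simp add: Un_commute flip: image_Un)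
  moreover have "g ` ?O \<inter> g ` ?I = {}"
    using J bij by (simp add: bij_is_inj Int_commute flip: image_Int)
  moreover have "frontier (g ` ?O) = C" "frontier (g ` ?I) = C"
    using J gc fg bij by (simp_all add: frontier_bijective_linear_image)
  moreover have op: "open (g ` ?O)" "open (g ` ?I)"
    using J fg bij by (simp_all add: open_bijective_linear_image_eq)
  moreover have "\<not> bounded (g ` ?O)"
  proof
    \<comment> \<open>Boundedness is pulled back along the inverse: \<open>f\<close> is bounded
      linear and returns the image to \<open>?O\<close>, which is unbounded.\<close>
    assume "bounded (g ` ?O)"
    then have "bounded (f ` g ` ?O)"
      by (rule bounded_linear_image) (simp add: fg linear_linear)
    then show False
      using J fg by (simp add: image_image)
  qed
  \<comment> \<open>\<open>J\<close> yields only connectedness, which openness upgrades to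
    path-connectedness.\<close>
  moreover have "path_connected (g ` ?O)"
    using J by (intro connected_open_path_connected op connected_linear_image fg) simp
  moreover have "bounded (g ` ?I)"
    using J by (intro bounded_linear_image) (simp_all add: fg linear_linear)
  \<comment> \<open>\<open>simply_connected\<close> makes any two loops freely homotopic; for
    constant loops this already gives path-connectedness of the inner region.\<close>
  ultimately show ?thesis
    using sc simply_connected_imp_path_connected[OF sc] by (intro exI[of _ "g ` ?O"] exI[of _ "g ` ?I"]) simp
qed

end
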